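(* Let $m \geq 3$ and $r \geq 1$ be integers. If $m$ is odd and $r=1$, then the propagation time of the generalized gear graph is $\mathrm{pt}\big(Gr(m,r)\big) = m-1$. Otherwise, $\mathrm{pt}\big(Gr(m,r)\big) = \left\lceil \frac{m(r+1)}{2} \right\rceil - 2$.
   Context: The generalized gear graph $Gr(m,r)$ is the (simple, undirected) graph with vertex set $\{v_i\}_{i=0}^{m(r+1)}$ such that distinct vertices $v_i, v_j$ are adjacent if and only if (for some ordering of the two indices) one of the following holds: (1) $i=0$ and $(r+1) \mid j$; (2) $i,j \neq 0$ and $|i-j|=1$; (3) $\{i,j\} = \{1, m(r+1)\}$. Thus $v_1,\dots,v_{m(r+1)}$ form a cycle and the center $v_0$ is adjacent to the $m$ vertices $v_{(r+1)k}$, $1\le k\le m$. Zero forcing: each vertex of a graph $G$ is initially colored blue or white. Color change rule: if $u$ is blue and $v$ is the only white neighbor of $u$, then $u$ can force $v$ to become blue; blue vertices stay blue. A set $B \subseteq V(G)$ is a zero forcing set of $G$ if, starting with exactly the vertices of $B$ blue, repeated application of the rule eventually makes every vertex blue. The zero forcing number $\mathrm{Z}(G)$ is the minimum cardinality of a zero forcing set of $G$. Propagation time: for a zero forcing set $B$ let $B^{[0]} = B$ and, for $k \geq 1$, let $B^{[k]} = B^{[k-1]} \cup B^{(k)}$, where $B^{(k)}$ is the set of all white vertices that can be forced by the color change rule when $B^{[k-1]}$ is exactly the set of blue vertices (all possible forces are performed simultaneously in each time-step). Then $\mathrm{pt}(G,B)$ is the least $k$ with $B^{[k]} = V(G)$,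 and $\mathrm{pt}(G) = \min\{\mathrm{pt}(G,B) : B \text{ is a zero forcing set of } G \text{ with } |B| = \mathrm{Z}(G)\}$. *)

theory Defs
  imports "Graph_Theory.Graph_Theory"
begin

text \<open>
  A finite simple undirected graph is a \<^locale>\<open>pair_graph\<close>: finitely many vertices, no loops,
  and every edge represented by both of its orientations.
\<close>

definition gear_adj :: "nat \<Rightarrow> nat \<Rightarrow> nat \<Rightarrow> nat \<Rightarrow> bool" where
  "gear_adj m r i j \<longleftrightarrow>
     i = 0 \<and> (r + 1) dvd j \<or>
     i \<noteq> 0 \<and> j \<noteq> 0 \<and> \<bar>int i - int j\<bar> = 1 \<or>
     {i, j} = {1, m * (r + 1)}"

definition gear_graph :: "nat \<Rightarrow> nat \<Rightarrow> nat pair_pre_digraph" where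
  "gear_graph m r =
     \<lparr> pverts = {0..m * (r + 1)},
       parcs = {(i, j). i \<in> {0..m * (r + 1)} \<and> j \<in> {0..m * (r + 1)} \<and> i \<noteq> j \<and>
                        (gear_adj m r i j \<or> gear_adj m r j i)} \<rparr>"

lemma pair_graph_gear_graph: "pair_graph (gear_graph m r)"
proof
  show "finite (parcs (gear_graph m r))"
    by (rule finite_subset[of _ "{0..m * (r + 1)} \<times> {0..m * (r + 1)}"])
       (auto simp: gear_graph_def)
  show "symmetric (with_proj (gear_graph m r))"
    by (auto simp: symmetric_def sym_def gear_graph_def arcs_ends_def arc_to_ends_def)
qed (auto simp: gear_graph_def)

definition can_force :: "'a pair_pre_digraph \<Rightarrow> 'a set \<Rightarrow> 'a \<Rightarrow> 'a \<Rightarrow> bool" where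
  "can_force G B u v \<longleftrightarrow> u \<in> B \<and> {w \<in> pverts G - B. (u, w) \<in> parcs G} = {v}"

definition force_step :: "'a pair_pre_digraph \<Rightarrow> 'a set \<Rightarrow> 'a set \<Rightarrow> bool" where
  "force_step G B B' \<longleftrightarrow> (\<exists>u v. can_force G B u v \<and> B' = insert v B)"

definition zero_forcing_set :: "'a pair_pre_digraph \<Rightarrow> 'a set \<Rightarrow> bool" where
  "zero_forcing_set G B \<longleftrightarrow> B \<subseteq> pverts G \<and> (force_step G)\<^sup>*\<^sup>* B (pverts G)"

definition zero_forcing_number :: "'a pair_pre_digraph \<Rightarrow> nat" where
  "zero_forcing_number G = (INF B \<in> {B. zero_forcing_set G B}. card B)"

primrec blue_after :: "'a pair_pre_digraph \<Rightarrow> 'a set \<Rightarrow> nat \<Rightarrow> 'a set" where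
  "blue_after G B 0 = B"
| "blue_after G B (Suc k) =
     blue_after G B k \<union> {v. \<exists>u. can_force G (blue_after G B k) u v}"

definition propagation_time_of :: "'a pair_pre_digraph \<Rightarrow> 'a set \<Rightarrow> nat" where
  "propagation_time_of G B = (LEAST k. blue_after G B k = pverts G)"

definition propagation_time :: "'a pair_pre_digraph \<Rightarrow> nat" where
  "propagation_time G =
     (INF B \<in> {B. zero_forcing_set G B \<and> card B = zero_forcing_number G}.
        propagation_time_of G B)"

text \<open>
  The minima above are attained on finite graphs, and a zero forcing set, defined by forces
  performed one at a time, also turns every vertex blue under simultaneous forcing, so no
  \<open>LEAST\<close> or \<open>INF\<close> is taken over an empty set.
\<close>

lemma blue_after_subset:
  assumes "B \<subseteq> pverts G"
  shows "blue_after G B k \<subseteq> pverts G"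
proof (induction k)
  case (Suc k)
  have "v \<in> pverts G" if "can_force G C u v" for C u v
    using that unfolding can_force_def by blast
  with Suc show ?case by auto
qed (use assms in simp)

lemma blue_after_force:
  assumes "C \<subseteq> blue_after G B k" "can_force G C u v"
  shows "insert v C \<subseteq> blue_after G B (Suc k)"
proof -
  have "can_force G (blue_after G B k) u v" if "v \<notin> blue_after G B k"
    using assms that unfolding can_force_def by blast
  then show ?thesis using assms(1) by auto
qed

lemma zero_forcing_set_imp_blue_after:
  assumes "zero_forcing_set G B"
  shows "\<exists>k. blue_after G B k = pverts G"
proof -
  have "\<exists>k. C \<subseteq> blue_after G B k" if "(force_step G)\<^sup>*\<^sup>* B C" for C
    using that
  proof (induction rule: rtranclp_induct)
    case base
    show ?case by (rule exI[of _ 0]) simp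
  next
    case (step C D)
    then show ?case unfolding force_step_def by (metis blue_after_force)
  qed
  with assms blue_after_subset show ?thesis
    unfolding zero_forcing_set_def by (metis subset_antisym)
qed

lemma propagation_time_of_attained:
  assumes "zero_forcing_set G B"
  shows "blue_after G B (propagation_time_of G B) = pverts G"
  unfolding propagation_time_of_def
  using zero_forcing_set_imp_blue_after[OF assms] by (rule LeastI_ex)

lemma zero_forcing_number_attained:
  "\<exists>B. zero_forcing_set G B \<and> card B = zero_forcing_number G"
proof -
  have "zero_forcing_set G (pverts G)" by (simp add: zero_forcing_set_def)
  then have "zero_forcing_number G \<in> card ` {B. zero_forcing_set G B}"
    unfolding zero_forcing_number_def by (intro Inf_nat_def1) auto
  then show ?thesis by auto
qed

lemma propagation_time_attained:
  "\<exists>B. zero_forcing_set G B \<and> card B = zero_forcing_number G \<and>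
       propagation_time_of G B = propagation_time G"
proof -
  have "propagation_time G \<in>
      propagation_time_of G ` {B. zero_forcing_set G B \<and> card B = zero_forcing_number G}"
    unfolding propagation_time_def
    using zero_forcing_number_attained[of G] by (intro Inf_nat_def1) auto
  then show ?thesis by auto
qed

end

theory Submission
  imports Defs
begin

text \<open>
  A head is a blue vertex with a white neighbor. Starting from three blue vertices there are never
  more than three heads, and this allows at most two forces along the rim per time-step, while the
  center is forced at most once and forces at most once. Hence \<open>m (r + 1) \<le> 2 k + 4\<close> if
  \<open>k\<close> steps suffice. Three consecutive vertices around a hub attain this bound unless \<open>m\<close>
  and \<open>r\<close> are both odd, when the two sides run symmetrically and the center cannot force. For
  \<open>r \<ge> 3\<close> an off-center start breaks the symmetry; for \<open>r = 1\<close> every start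
  other than the symmetric one loses a rim force, which costs one step.
\<close>

section \<open>Simultaneous versus sequential forcing\<close>

lemma blue_after_mono: "i \<le> j \<Longrightarrow> blue_after G B i \<subseteq> blue_after G B j"
  by (induction j) (auto simp: le_Suc_eq)

text \<open>\<open>v\<close> may already be blue, so later growth arguments need not show that the
  vertices they reach were white.\<close>

lemma blue_after_SucI:
  assumes "u \<in> blue_after G B k" "(u, v) \<in> parcs G" "v \<in> pverts G"
    and "\<And>w. (u, w) \<in> parcs G \<Longrightarrow> w \<noteq> v \<Longrightarrow> w \<in> blue_after G B k"
  shows "v \<in> blue_after G B (Suc k)"
proof (cases "v \<in> blue_after G B k")
  case False
  then have "can_force G (blue_after G B k) u v"
    using assms unfolding can_force_def by blast
  then show ?thesis by auto
qed simp

text \<open>Each forcer has a single white neighbor, so the other forces leave its own force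
  available and one time-step can be performed one force at a time.\<close>

lemma force_steps_simultaneous:
  assumes "finite F" and "\<And>v. v \<in> F \<Longrightarrow> \<exists>u. can_force G S u v"
  shows "(force_step G)\<^sup>*\<^sup>* S (S \<union> F)"
  using assms
proof (induction F rule: finite_induct)
  case (insert v F)
  then obtain u where u: "can_force G S u v" by blast
  then have "can_force G (S \<union> F) u v"
    using insert.hyps unfolding can_force_def by blast
  then have "force_step G (S \<union> F) (insert v (S \<union> F))"
    unfolding force_step_def by blast
  with insert show ?case by (simp add: rtranclp.rtrancl_into_rtrancl)
qed simp

lemma force_steps_blue_after:
  assumes "finite (pverts G)"
  shows "(force_step G)\<^sup>*\<^sup>* B (blue_after G B k)"
proof (induction k)
  case (Suc k)
  have "{v. \<exists>u. can_force G (blue_after G B k) u v} \<subseteq> pverts G"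
    unfolding can_force_def by blast
  then have "(force_step G)\<^sup>*\<^sup>* (blue_after G B k) (blue_after G B (Suc k))"
    using assms by (auto intro!: force_steps_simultaneous intro: finite_subset)
  with Suc show ?case by (rule rtranclp_trans)
qed simp

lemma zero_forcing_setI:
  assumes "finite (pverts G)" "B \<subseteq> pverts G" "blue_after G B k = pverts G"
  shows "zero_forcing_set G B"
  using force_steps_blue_after[OF assms(1), of B k] assms
  unfolding zero_forcing_set_def by simp

lemma zero_forcing_number_le:
  "zero_forcing_set G B \<Longrightarrow> zero_forcing_number G \<le> card B"
  unfolding zero_forcing_number_def by (intro cInf_lower) auto

lemma propagation_time_le:
  assumes "zero_forcing_set G B" "card B = zero_forcing_number G" "blue_after G B k = pverts G"
  shows "propagation_time G \<le> k"
proof -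
  have "propagation_time G \<le> propagation_time_of G B"
    unfolding propagation_time_def using assms by (intro cInf_lower) auto
  also have "\<dots> \<le> k"
    unfolding propagation_time_of_def using assms(3) by (rule Least_le)
  finally show ?thesis .
qed

lemma can_forceD:
  assumes "can_force G S u v"
  shows "u \<in> S" "v \<notin> S" "v \<in> pverts G" "(u, v) \<in> parcs G"
  using assms unfolding can_force_def by auto

lemma can_force_unique:
  assumes "can_force G S u v" "(u, w) \<in> parcs G" "w \<in> pverts G"
  shows "w \<in> S \<or> w = v"
  using assms unfolding can_force_def by auto

section \<open>Heads and boundary counts\<close>

definition heads :: "'a pair_pre_digraph \<Rightarrow> 'a set \<Rightarrow> 'a set" where
  "heads G S = {u \<in> S. \<exists>w \<in> pverts G - S. (u, w) \<in> parcs G}"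

text \<open>A vertex that forces has no white neighbour left, so each newly blue vertex replaces its forcer.\<close>

lemma card_heads_blue_after:
  assumes "finite (pverts G)" "B \<subseteq> pverts G"
  shows "card (heads G (blue_after G B k)) \<le> card B"
proof (induction k)
  case 0
  have "finite B" using assms by (rule rev_finite_subset)
  then show ?case by (auto simp: heads_def intro!: card_mono)
next
  case (Suc k)
  let ?S = "blue_after G B k" and ?S' = "blue_after G B (Suc k)"
  let ?new = "{v. \<exists>u. can_force G ?S u v}"
  define f where "f v = (SOME u. can_force G ?S u v)" for v
  have f: "can_force G ?S (f v) v" if "v \<in> ?new" for v
    using that unfolding f_def by (auto intro: someI)
  define g where "g v = (if v \<in> ?new then f v else v)" for v
  have fin: "finite (heads G ?S)"
    using blue_after_subset[OF assms(2), of k] assms(1)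
    by (auto simp: heads_def intro: finite_subset)
  have f_head: "f v \<in> heads G ?S" if "v \<in> ?new" for v
    using f[OF that] unfolding can_force_def heads_def by blast
  have f_not_head: "f v \<notin> heads G ?S'" if "v \<in> ?new" for v
  proof -
    have "w \<in> ?S'" if "w \<in> pverts G" "(f v, w) \<in> parcs G" for w
      using can_force_unique[OF f[OF \<open>v \<in> ?new\<close>] that(2,1)] \<open>v \<in> ?new\<close> by auto
    then show ?thesis unfolding heads_def by blast
  qed
  have inj: "inj_on g (heads G ?S')"
  proof (rule inj_onI)
    fix v w assume vw: "v \<in> heads G ?S'" "w \<in> heads G ?S'" "g v = g w"
    show "v = w"
    proof (cases "v \<in> ?new"; cases "w \<in> ?new")
      assume "v \<in> ?new" "w \<in> ?new"
      then have "can_force G ?S (f v) v" "can_force G ?S (f v) w"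
        using f[of v] f[of w] vw(3) by (auto simp: g_def)
      then show ?thesis unfolding can_force_def by auto
    qed (use vw f_not_head[of v] f_not_head[of w] in \<open>auto simp: g_def\<close>)
  qed
  have "g ` heads G ?S' \<subseteq> heads G ?S"
  proof clarify
    fix v assume v: "v \<in> heads G ?S'"
    show "g v \<in> heads G ?S"
    proof (cases "v \<in> ?new")
      case True
      then show ?thesis using f_head by (simp add: g_def)
    next
      case False
      then show ?thesis using v by (auto simp: g_def heads_def)
    qed
  qed
  then have "card (heads G ?S') \<le> card (heads G ?S)"
    using inj fin by (meson card_inj_on_le)
  with Suc show ?case by linarith
qed

text \<open>\<open>f\<close> maps the elements it keeps in \<open>T\<close> bijectively onto those
  that \<open>g\<close> keeps in \<open>T\<close>, so the complements in \<open>T\<close> have equal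
  size. For successor and predecessor on the rim this matches right ends of blue runs with left
  ends.\<close>

lemma card_boundary_eq:
  assumes "finite T" "\<And>u. u \<in> T \<Longrightarrow> g (f u) = u" "\<And>u. u \<in> T \<Longrightarrow> f (g u) = u"
  shows "card {u \<in> T. f u \<notin> T} = card {u \<in> T. g u \<notin> T}"
proof -
  have "bij_betw f {u \<in> T. f u \<in> T} {u \<in> T. g u \<in> T}"
    by (rule bij_betw_byWitness[where f' = g]) (use assms in auto)
  then have eq: "card {u \<in> T. f u \<in> T} = card {u \<in> T. g u \<in> T}"
    by (rule bij_betw_same_card)
  have split: "card T = card {u \<in> T. P u} + card {u \<in> T. \<not> P u}" for P
  proof -
    have "T = {u \<in> T. P u} \<union> {u \<in> T. \<not> P u}" by auto
    then show ?thesis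
      using assms(1) card_Un_disjoint[of "{u \<in> T. P u}" "{u \<in> T. \<not> P u}"] by auto
  qed
  show ?thesis
    using split[of "\<lambda>u. f u \<in> T"] split[of "\<lambda>u. g u \<in> T"] eq by simp
qed

section \<open>Integer coordinates on the rim\<close>

locale gear =
  fixes m r :: nat
  assumes m_ge: "m \<ge> 3" and r_ge: "r \<ge> 1"
begin

abbreviation G :: "nat pair_pre_digraph" where "G \<equiv> gear_graph m r"

definition N :: int where "N = int (m * (r + 1))"

definition d :: int where "d = int (r + 1)"

text \<open>Wraps integer coordinates around the rim. The shift by one makes the representatives 1
  to \<open>N\<close> agree with the vertex labels, as label 0 is the center. Hubs are the images of
  the multiples of \<open>d\<close>.\<close>

definition cyc :: "int \<Rightarrow> nat" where "cyc x = nat ((x - 1) mod N) + 1"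

lemma N_eq: "N = int m * d"
  by (simp add: N_def d_def algebra_simps)

lemma d_ge: "d \<ge> 2"
  using r_ge by (simp add: d_def)

lemma N_ge: "N \<ge> 6" and N_ge': "N \<ge> 3 * d"
proof -
  show "N \<ge> 3 * d" using m_ge d_ge unfolding N_eq by (intro mult_right_mono) auto
  then show "N \<ge> 6" using d_ge by linarith
qed

lemma d_dvd_N: "d dvd N"
  by (simp add: N_eq)

lemma cyc_eq_iff: "cyc x = cyc y \<longleftrightarrow> N dvd x - y"
proof -
  have "cyc x = cyc y \<longleftrightarrow> (x - 1) mod N = (y - 1) mod N"
    using N_ge by (simp add: cyc_def nat_eq_iff)
  also have "\<dots> \<longleftrightarrow> N dvd x - y"
    by (simp add: mod_eq_dvd_iff)
  finally show ?thesis .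
qed

lemma mod_N: "0 \<le> x mod N" "x mod N < N"
  using N_ge by (simp_all add: pos_mod_sign pos_mod_bound)

lemma int_cyc: "int (cyc x) = (x - 1) mod N + 1"
  using N_ge by (simp add: cyc_def)

lemma cyc_pos [simp]: "cyc x \<noteq> 0" "0 \<noteq> cyc x" "0 < cyc x"
  by (simp_all add: cyc_def)

lemma cyc_le: "int (cyc x) \<le> N"
  using mod_N(2)[of "x - 1"] by (simp add: int_cyc)

lemma cyc_int: "1 \<le> v \<Longrightarrow> int v \<le> N \<Longrightarrow> cyc (int v) = v"
  using N_ge by (simp add: cyc_def)

lemma cyc_int_cyc [simp]: "cyc (int (cyc x)) = cyc x"
  using cyc_le cyc_pos by (intro cyc_int) (auto simp: Suc_le_eq)

lemma cyc_shift: "cyc x = cyc y \<Longrightarrow> cyc (x + a) = cyc (y + a)"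
  by (simp add: cyc_eq_iff)

text \<open>Being a hub does not depend on the chosen coordinate because \<open>d\<close> divides
  \<open>N\<close>.\<close>

lemma dvd_cyc: "cyc x = cyc y \<Longrightarrow> d dvd x \<longleftrightarrow> d dvd y"
proof -
  assume "cyc x = cyc y"
  then have "d dvd x - y" using d_dvd_N dvd_trans by (auto simp: cyc_eq_iff)
  then show ?thesis by (metis dvd_diff_commute dvd_diff_left_iff dvd_diff_right_iff)
qed

lemma range_cyc: "range cyc = {1..m * (r + 1)}"
proof
  show "range cyc \<subseteq> {1..m * (r + 1)}"
    using cyc_le unfolding N_def of_nat_le_iff by (auto simp: Suc_le_eq)
  show "{1..m * (r + 1)} \<subseteq> range cyc"
    using cyc_int unfolding N_def of_nat_le_iff by (auto intro!: image_eqI[OF sym])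
qed

lemma pverts_eq: "pverts G = insert 0 (range cyc)"
  unfolding range_cyc by (auto simp: gear_graph_def)

lemma finite_pverts: "finite (pverts G)"
  by (simp add: gear_graph_def)

lemma pverts_cases:
  assumes "v \<in> pverts G"
  obtains "v = 0" | x where "v = cyc x"
  using assms by (auto simp: pverts_eq)

lemma cyc_in_pverts [simp]: "cyc x \<in> pverts G" and zero_in_pverts [simp]: "0 \<in> pverts G"
  by (simp_all add: pverts_eq)

lemma card_range_cyc: "int (card (range cyc)) = N"
  unfolding range_cyc by (simp add: N_def)

lemma finite_range_cyc: "finite (range cyc)"
  unfolding range_cyc by simp

text \<open>The separate edge between 1 and \<open>N\<close> is exactly the wrap-around of
  \<open>cyc\<close>, so neighbors on the rim become \<open>+ 1\<close> and \<open>- 1\<close>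
  without end cases.\<close>

lemma arc_iff_aux:
  assumes "1 \<le> v" "int v \<le> N"
  shows "(v, w) \<in> parcs G \<longleftrightarrow>
    w = cyc (int v + 1) \<or> w = cyc (int v - 1) \<or> w = 0 \<and> d dvd int v"
proof -
  define M where "M = m * (r + 1)"
  have M: "N = int M" by (simp add: N_def M_def)
  have M6: "6 \<le> M" "v \<le> M" using N_ge assms unfolding M by auto
  have succ: "cyc (int v + 1) = (if v = M then 1 else v + 1)"
    using assms M6 by (auto simp: cyc_def M nat_mod_distrib nat_add_distrib)
  have "cyc (int v - 1) = cyc (if v = 1 then int M else int (v - 1))"
    using assms M6 by (auto simp: cyc_eq_iff M)
  also have "\<dots> = (if v = 1 then M else v - 1)"
    using assms M6 cyc_int[of M] cyc_int[of "v - 1"] by (auto simp: M of_nat_diff)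
  finally have pred: "cyc (int v - 1) = (if v = 1 then M else v - 1)" .
  have dv: "d dvd int v \<longleftrightarrow> (r + 1) dvd v" unfolding d_def by (rule int_dvd_int_iff)
  have "(v, w) \<in> parcs G \<longleftrightarrow> w \<le> M \<and> v \<noteq> w \<and>
     (w = 0 \<and> (r + 1) dvd v \<or> w \<noteq> 0 \<and> \<bar>int v - int w\<bar> = 1 \<or> v = 1 \<and> w = M \<or> v = M \<and> w = 1)"
    using assms M6 unfolding gear_graph_def gear_adj_def M_def[symmetric]
    by (auto simp: doubleton_eq_iff)
  also have "\<dots> \<longleftrightarrow> w = (if v = M then 1 else v + 1) \<or> w = (if v = 1 then M else v - 1)
      \<or> w = 0 \<and> (r + 1) dvd v"
    using assms M6 by (auto split: if_splits)
  finally show ?thesis unfolding succ pred dv .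
qed

lemma arc_iff:
  "(cyc x, w) \<in> parcs G \<longleftrightarrow> w = cyc (x + 1) \<or> w = cyc (x - 1) \<or> w = 0 \<and> d dvd x"
proof -
  have e: "cyc (int (cyc x)) = cyc x" by simp
  show ?thesis
    using arc_iff_aux[of "cyc x" w] cyc_le[of x] dvd_cyc[OF e]
      cyc_shift[OF e, of 1] cyc_shift[OF e, of "-1"] by (simp add: Suc_le_eq)
qed

lemma arc_zero_iff: "(0, w) \<in> parcs G \<longleftrightarrow> (\<exists>x. d dvd x \<and> w = cyc x)"
proof -
  have "(0, w) \<in> parcs G \<Longrightarrow> w \<in> range cyc"
    unfolding range_cyc by (auto simp: gear_graph_def)
  moreover have "(0, w) \<in> parcs G \<longleftrightarrow> (w, 0) \<in> parcs G"
    by (auto simp: gear_graph_def)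
  ultimately show ?thesis
    using arc_iff dvd_cyc by (metis cyc_pos(1) rangeE)
qed

lemma cyc_near: "\<bar>x - y\<bar> < N \<Longrightarrow> cyc x = cyc y \<longleftrightarrow> x = y"
proof -
  assume "\<bar>x - y\<bar> < N"
  then have "N dvd x - y \<Longrightarrow> x - y = 0"
    using dvd_imp_le_int[of "x - y" N] N_ge by linarith
  then show ?thesis by (auto simp: cyc_eq_iff)
qed

section \<open>Constraints on a single force\<close>

lemma can_force_rim:
  "can_force G S (cyc x) v \<Longrightarrow> v = cyc (x + 1) \<or> v = cyc (x - 1) \<or> v = 0 \<and> d dvd x"
  by (auto dest!: can_forceD(4) simp: arc_iff)

lemma white_rim:
  assumes "can_force G S (cyc x) v" "a = x + 1 \<or> a = x - 1"
  shows "cyc a \<in> S \<or> cyc a = v"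
  using can_force_unique[OF assms(1), of "cyc a"] assms(2) by (auto simp: arc_iff)

lemma white_centre:
  "can_force G S (cyc x) v \<Longrightarrow> d dvd x \<Longrightarrow> 0 \<in> S \<or> v = 0"
  using can_force_unique[of G S "cyc x" v 0] by (auto simp: arc_iff)

lemma white_hub:
  "can_force G S 0 v \<Longrightarrow> d dvd y \<Longrightarrow> cyc y \<in> S \<or> cyc y = v"
  using can_force_unique[of G S 0 v "cyc y"] by (auto simp: arc_zero_iff)

section \<open>Three vertices are necessary\<close>

text \<open>The center is white, so a hub at either end of the segment has two white neighbors, the
  center and its outer rim neighbor, and cannot force. Inner vertices are not hubs and only reach
  rim neighbors inside the segment.\<close>

lemma force_in_hub_interval:
  assumes S: "S \<subseteq> cyc ` {a..a + d}" and a: "d dvd a" and force: "can_force G S u v"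
  shows "v \<in> cyc ` {a..a + d}"
proof -
  obtain x where x: "u = cyc x" "a \<le> x" "x \<le> a + d"
    using S can_forceD(1)[OF force] by auto
  have zero: "0 \<notin> S" using S by auto
  have out: "cyc (a - 1) \<notin> S" "cyc (a + d + 1) \<notin> S"
  proof -
    have ne: "cyc (a - 1) \<noteq> cyc y" "cyc (a + d + 1) \<noteq> cyc y" if "y \<in> {a..a + d}" for y
      using that N_ge' d_ge cyc_near[of "a - 1" y] cyc_near[of "a + d + 1" y] by auto
    show "cyc (a - 1) \<notin> S" "cyc (a + d + 1) \<notin> S" using S ne by blast+
  qed
  have "x \<noteq> a"
  proof
    assume "x = a"
    then have "v = 0" "cyc (a - 1) = v"
      using white_centre[of S x v] white_rim[of S x v "a - 1"] force x a zero out by auto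
    then show False by simp
  qed
  moreover have "x \<noteq> a + d"
  proof
    assume "x = a + d"
    then have "v = 0" "cyc (a + d + 1) = v"
      using white_centre[of S x v] white_rim[of S x v "a + d + 1"] force x a zero out by auto
    then show False by simp
  qed
  ultimately have inside: "a < x" "x < a + d" using x by auto
  have "\<not> d dvd x"
  proof
    assume "d dvd x"
    then have "d dvd x - a" using a by simp
    then show False using inside zdvd_imp_le[of d "x - a"] by linarith
  qed
  then consider "v = cyc (x + 1)" | "v = cyc (x - 1)"
    using can_force_rim force x(1) by blast
  then show ?thesis using inside by cases auto
qed

text \<open>A force by the center or by a hub already needs three blue vertices. With two, the first
  forcer is therefore a rim vertex that is not a hub, and the blue set stays trapped between two
  consecutive hubs.\<close>

lemma zero_forcing_card_ge:
  assumes "zero_forcing_set G B"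
  shows "3 \<le> card B"
proof (rule ccontr)
  assume "\<not> 3 \<le> card B"
  then have small: "card B \<le> 2" by simp
  have sub: "B \<subseteq> pverts G" using assms by (simp add: zero_forcing_set_def)
  have fin: "finite B" using sub finite_pverts by (rule finite_subset)
  obtain k where k: "blue_after G B k = pverts G"
    using zero_forcing_set_imp_blue_after[OF assms] by blast
  have "B \<noteq> pverts G"
  proof
    assume "B = pverts G"
    moreover have "range cyc \<subseteq> pverts G" by (simp add: pverts_eq subset_insertI)
    ultimately have "card (range cyc) \<le> 2"
      using small card_mono[OF finite_pverts, of "range cyc"] by simp
    then show False using card_range_cyc N_ge by simp
  qed
  have "\<exists>u v. can_force G B u v"
  proof (rule ccontr)
    assume "\<nexists>u v. can_force G B u v"
    then have "blue_after G B k = B" by (induction k) simp_all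
    with k \<open>B \<noteq> pverts G\<close> show False by simp
  qed
  then obtain u v where force: "can_force G B u v" by blast
  \<comment> \<open>Applied to the forcer together with three of its neighbors: all of these except
    \<open>v\<close> are blue, so four distinct vertices give a contradiction.\<close>
  have bound: "card X \<le> 3" if "finite X" "X - {v} \<subseteq> B" for X
  proof -
    have "card X - 1 \<le> card (X - {v})" using diff_card_le_card_Diff[of "{v}" X] by simp
    also have "\<dots> \<le> card B" using that fin by (intro card_mono)
    finally show ?thesis using small by simp
  qed
  obtain x where x: "u = cyc x" "\<not> d dvd x"
  proof -
    have "u \<in> pverts G" using can_forceD(1)[OF force] sub by auto
    then show thesis
    proof (cases rule: pverts_cases)
      case 1
      let ?X = "{0, cyc 0, cyc d, cyc (2 * d)}"
      have "?X - {v} \<subseteq> B"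
        using 1 force can_forceD(1)[OF force] white_hub[of B v 0] white_hub[of B v d] white_hub[of B v "2 * d"]
        by auto
      then have "card ?X \<le> 3" by (intro bound) auto
      moreover have "cyc 0 \<noteq> cyc d" "cyc 0 \<noteq> cyc (2 * d)" "cyc d \<noteq> cyc (2 * d)"
        using N_ge' d_ge by (simp_all add: cyc_near)
      ultimately show thesis by simp
    next
      case (2 x)
      show thesis
      proof (cases "d dvd x")
        case True
        let ?X = "{0, cyc x, cyc (x + 1), cyc (x - 1)}"
        have "?X - {v} \<subseteq> B"
          using 2 True force can_forceD(1)[OF force] white_centre[of B x v]
            white_rim[of B x v "x + 1"] white_rim[of B x v "x - 1"]
          by auto
        then have "card ?X \<le> 3" by (intro bound) auto
        moreover have "cyc x \<noteq> cyc (x + 1)" "cyc x \<noteq> cyc (x - 1)" "cyc (x + 1) \<noteq> cyc (x - 1)"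
          using N_ge by (simp_all add: cyc_near)
        ultimately show thesis by simp
      qed (use 2 that in blast)
    qed
  qed
  let ?X = "{cyc x, cyc (x + 1), cyc (x - 1)}"
  have "?X - {v} \<subseteq> B"
    using x force can_forceD(1)[OF force] white_rim[of B x v "x + 1"] white_rim[of B x v "x - 1"]
    by auto
  moreover have "card ?X = 3"
    using N_ge by (simp add: cyc_near)
  ultimately have "?X - {v} = B"
    using small fin by (intro card_seteq) (auto simp: card_Diff_singleton_if)
  then have B: "B \<subseteq> ?X" by blast
  \<comment> \<open>The last hub coordinate before \<open>x\<close>; as \<open>x\<close> is not a
    hub, \<open>x - 1\<close> and \<open>x + 1\<close> stay in the closed segment.\<close>
  define a where "a = x - x mod d"
  have a: "d dvd a" unfolding a_def by (simp add: minus_mod_eq_mult_div)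
  have "x mod d \<noteq> 0" using x(2) by blast
  then have "0 < x mod d" "x mod d < d"
    using d_ge pos_mod_sign[of d x] pos_mod_bound[of d x] by linarith+
  then have "?X \<subseteq> cyc ` {a..a + d}" unfolding a_def by auto
  with B have B: "B \<subseteq> cyc ` {a..a + d}" by blast
  have "blue_after G B k \<subseteq> cyc ` {a..a + d}"
  proof (induction k)
    case (Suc k)
    then show ?case using force_in_hub_interval[OF Suc a] by (simp, blast)
  qed (simp add: B)
  then show False unfolding k by (auto simp: pverts_eq)
qed

section \<open>Counting forces along the rim\<close>

definition rim :: "nat set \<Rightarrow> nat set" where "rim S = S \<inter> range cyc"

definition hubs :: "nat set" where "hubs = cyc ` {x. d dvd x}"

definition nxt :: "nat \<Rightarrow> nat" where "nxt v = cyc (int v + 1)"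

definition prv :: "nat \<Rightarrow> nat" where "prv v = cyc (int v - 1)"

lemma nxt_cyc [simp]: "nxt (cyc x) = cyc (x + 1)"
  unfolding nxt_def by (rule cyc_shift) simp

lemma prv_cyc [simp]: "prv (cyc x) = cyc (x - 1)"
  unfolding prv_def using cyc_shift[of "int (cyc x)" x "-1"] by simp

lemma finite_rim [simp]: "finite (rim S)"
  unfolding rim_def by (rule finite_subset[OF Int_lower2 finite_range_cyc])

text \<open>
  As many maximal blue runs on the rim end to the right as to the left, and only an end of a run of
  length at least two can force along the rim; three such forces would need two runs and hence four
  heads.
\<close>

lemma card_rim_forces:
  assumes "finite S" "card (heads G S) \<le> 3"
  shows "card {v \<in> range cyc. \<exists>u \<in> range cyc. can_force G S u v} \<le> 2"
proof -
  \<comment> \<open>Right and left ends of blue runs. \<open>R \<inter> L\<close> holds the isolated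
    blue vertices, so \<open>R - L\<close> and \<open>L - R\<close> hold the ends of longer runs;
    \<open>g\<close> recovers the forced vertex from its forcer.\<close>
  define R where "R = {u \<in> rim S. nxt u \<notin> rim S}"
  define L where "L = {u \<in> rim S. prv u \<notin> rim S}"
  define g where "g u = (if nxt u \<notin> S then nxt u else prv u)" for u
  have fin: "finite R" "finite L" by (simp_all add: R_def L_def)
  have RL: "card R = card L" unfolding R_def L_def
  proof (rule card_boundary_eq)
    show "finite (rim S)" by simp
  qed (auto simp: rim_def)
  have "R \<union> L \<subseteq> heads G S"
    by (auto simp: R_def L_def rim_def heads_def arc_iff)
  moreover have "finite (heads G S)" using assms(1) by (simp add: heads_def)
  ultimately have "card (R \<union> L) \<le> 3"
    using assms(2) card_mono le_trans by blast
  moreover have "card R = card (R \<inter> L) + card (R - L)" "card L = card (R \<inter> L) + card (L - R)"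
    using card_Int_Diff[OF fin(1), of L] card_Int_Diff[OF fin(2), of R] by (simp_all only: Int_commute)
  moreover have "card R + card L = card (R \<union> L) + card (R \<inter> L)"
    by (rule card_Un_Int[OF fin])
  \<comment> \<open>The two differences are equal in size and together have at most three elements,
    so each has at most one.\<close>
  ultimately have eq: "card (R - L) = card (L - R)" and "2 * card (R - L) \<le> 3"
    using RL by linarith+
  then have "card (R - L) \<le> 1" by linarith
  with eq have X: "card (R - L) + card (L - R) \<le> 2" by linarith
  have "{v \<in> range cyc. \<exists>u \<in> range cyc. can_force G S u v} \<subseteq> g ` ((R - L) \<union> (L - R))"
  proof
    fix v assume "v \<in> {v \<in> range cyc. \<exists>u \<in> range cyc. can_force G S u v}"
    then obtain x where v: "v \<in> range cyc" and force: "can_force G S (cyc x) v" by blast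
    have ne: "cyc (x + 1) \<noteq> cyc (x - 1)" using N_ge by (simp add: cyc_near)
    have S: "cyc x \<in> S" "v \<notin> S" using can_forceD[OF force] by blast+
    have "v \<noteq> 0" using v by auto
    then have "v = cyc (x + 1) \<or> v = cyc (x - 1)" using can_force_rim[OF force] by blast
    then show "v \<in> g ` ((R - L) \<union> (L - R))"
    proof
      assume v: "v = cyc (x + 1)"
      then have "cyc (x - 1) \<in> S" using white_rim[OF force, of "x - 1"] ne by simp
      then have "cyc x \<in> R - L" "v = g (cyc x)"
        using v S by (simp_all add: R_def L_def rim_def g_def)
      then show ?thesis by (intro image_eqI[of v g "cyc x"] UnI1)
    next
      assume v: "v = cyc (x - 1)"
      then have "cyc (x + 1) \<in> S" using white_rim[OF force, of "x + 1"] ne by simp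
      then have "cyc x \<in> L - R" "v = g (cyc x)"
        using v S by (simp_all add: R_def L_def rim_def g_def)
      then show ?thesis by (intro image_eqI[of v g "cyc x"] UnI2)
    qed
  qed
  then have "card {v \<in> range cyc. \<exists>u \<in> range cyc. can_force G S u v}
      \<le> card (g ` ((R - L) \<union> (L - R)))"
    using fin by (intro card_mono) auto
  also have "\<dots> \<le> card ((R - L) \<union> (L - R))"
    using fin by (intro card_image_le) auto
  also have "\<dots> \<le> card (R - L) + card (L - R)" by (rule card_Un_le)
  finally show ?thesis using X by linarith
qed

text \<open>The center forces a hub only when all other hubs are blue, so the indicator of
  \<open>hubs\<close> rises from 0 to 1 in that very step and pays for the force. The old indicator
  stands on the left to avoid subtraction; the inequality telescopes.\<close>

lemma card_rim_Suc:
  assumes B: "B \<subseteq> pverts G" "card B \<le> 3"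
  shows "card (rim (blue_after G B (Suc k))) + (if hubs \<subseteq> blue_after G B k then 1 else 0)
    \<le> card (rim (blue_after G B k)) + 2 + (if hubs \<subseteq> blue_after G B (Suc k) then 1 else 0)"
proof -
  let ?S = "blue_after G B k" and ?S' = "blue_after G B (Suc k)"
  let ?F = "{v \<in> range cyc. \<exists>u \<in> range cyc. can_force G ?S u v}"
  let ?C = "{v. can_force G ?S 0 v}"
  have subS: "?S \<subseteq> pverts G" by (rule blue_after_subset[OF B(1)])
  have F: "card ?F \<le> 2"
  proof (rule card_rim_forces)
    show "finite ?S" using subS finite_pverts by (rule finite_subset)
    show "card (heads G ?S) \<le> 3"
      using card_heads_blue_after[OF finite_pverts B(1), of k] B(2) by linarith
  qed
  have C: "finite ?C" "card ?C + (if hubs \<subseteq> ?S then 1 else 0) \<le> (if hubs \<subseteq> ?S' then 1 else 0)"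
  proof -
    have "finite ?C \<and> card ?C + (if hubs \<subseteq> ?S then 1 else 0) \<le> (if hubs \<subseteq> ?S' then 1 else (0::nat))"
    proof (cases "\<exists>v. can_force G ?S 0 v")
      case True
      then obtain v where v: "can_force G ?S 0 v" by blast
      then have "?C = {v}" unfolding can_force_def by auto
      moreover have "hubs \<subseteq> ?S'" using white_hub[OF v] v by (auto simp: hubs_def)
      moreover have "\<not> hubs \<subseteq> ?S"
        using can_forceD[OF v] by (auto simp: hubs_def arc_zero_iff)
      ultimately show ?thesis by simp
    next
      case False
      then have "?C = {}" by blast
      moreover have "?S \<subseteq> ?S'" by auto
      ultimately show ?thesis by auto
    qed
    then show "finite ?C" "card ?C + (if hubs \<subseteq> ?S then 1 else 0) \<le> (if hubs \<subseteq> ?S' then 1 else 0)"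
      by auto
  qed
  have sub: "rim ?S' \<subseteq> rim ?S \<union> ?F \<union> ?C"
  proof
    fix v assume v: "v \<in> rim ?S'"
    then have vr: "v \<in> range cyc" by (simp add: rim_def)
    have "v \<in> ?S \<or> (\<exists>u. can_force G ?S u v)" using v by (simp add: rim_def)
    then show "v \<in> rim ?S \<union> ?F \<union> ?C"
    proof
      assume "v \<in> ?S"
      then show ?thesis using vr by (simp add: rim_def)
    next
      assume "\<exists>u. can_force G ?S u v"
      then obtain u where u: "can_force G ?S u v" by blast
      have "u \<in> pverts G" using can_forceD(1)[OF u] subS by (rule rev_subsetD)
      then have "u = 0 \<or> u \<in> range cyc" unfolding pverts_eq by blast
      then show ?thesis using u vr by (elim disjE) blast+
    qed
  qed
  have "finite ?F" using finite_range_cyc by (rule rev_finite_subset) blast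
  then have "finite (rim ?S \<union> ?F \<union> ?C)" using C(1) by simp
  then have "card (rim ?S') \<le> card (rim ?S \<union> ?F \<union> ?C)"
    using sub by (rule card_mono)
  also have "\<dots> \<le> card (rim ?S) + card ?F + card ?C"
    using card_Un_le[of "rim ?S \<union> ?F" ?C] card_Un_le[of "rim ?S" ?F] by linarith
  finally show ?thesis using F C(2) by linarith
qed

lemma card_rim_le:
  assumes B: "B \<subseteq> pverts G" "card B \<le> 3" and "j \<le> k"
  shows "card (rim (blue_after G B k)) \<le>
    card (rim (blue_after G B j)) + 2 * (k - j) + (if hubs \<subseteq> blue_after G B k then 1 else 0)"
  using \<open>j \<le> k\<close>
proof (induction k rule: dec_induct)
  case (step k)
  have "2 * (Suc k - j) = 2 * (k - j) + 2" using step.hyps by simp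
  then show ?case using step.IH card_rim_Suc[OF B, of k] by linarith
qed simp

text \<open>The final 1 is the single force of the center. The starting time \<open>j\<close> is
  free so that a loss at the start or in the first step can be exploited.\<close>

lemma N_le_rim:
  assumes B: "B \<subseteq> pverts G" "card B \<le> 3" and "j \<le> k" and full: "blue_after G B k = pverts G"
  shows "N \<le> int (card (rim (blue_after G B j))) + 2 * (int k - int j) + 1"
proof -
  have "rim (pverts G) = range cyc" by (auto simp: rim_def pverts_eq)
  then have "card (range cyc) \<le> card (rim (blue_after G B j)) + 2 * (k - j) + 1"
    using card_rim_le[OF B \<open>j \<le> k\<close>] unfolding full by (auto split: if_splits)
  then have "int (card (range cyc)) \<le> int (card (rim (blue_after G B j)) + 2 * (k - j) + 1)"
    by (rule of_nat_mono)
  then show ?thesis using card_range_cyc \<open>j \<le> k\<close> by (simp add: of_nat_diff)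
qed

lemma N_le:
  assumes B: "B \<subseteq> pverts G" "card B \<le> 3" and full: "blue_after G B k = pverts G"
  shows "N \<le> 2 * int k + 4"
proof -
  have "finite B" using B(1) finite_pverts by (rule finite_subset)
  then have "card (rim B) \<le> card B" by (auto simp: rim_def intro: card_mono)
  then show ?thesis using N_le_rim[OF B le0 full] B(2) by simp
qed

section \<open>Lower bound for odd \<open>m\<close> and \<open>r = 1\<close>\<close>

text \<open>
  The reflection of the rim about the hub \<open>cyc x\<close> fixes no other hub when \<open>m\<close> is odd,
  so the white hubs come in pairs and the center never forces.
\<close>

lemma blue_after_symmetric:
  assumes m: "odd m" and x: "d dvd x" and B: "B \<subseteq> cyc ` {x - 1..x + 1}"
  shows "blue_after G B k \<subseteq> insert 0 (cyc ` {x - 1 - int k..x + 1 + int k})"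
proof (induction k)
  case (Suc k)
  let ?S = "blue_after G B k"
  let ?U = "\<lambda>k. insert 0 (cyc ` {x - 1 - int k..x + 1 + int k})"
  have mono: "?U k \<subseteq> ?U (Suc k)" by (intro insert_mono image_mono) auto
  have "v \<in> ?U (Suc k)" if force: "can_force G ?S u v" for u v
  proof -
    have "u \<in> ?U k" using Suc can_forceD(1)[OF force] by blast
    then consider "u = 0" | y where "u = cyc y" "y \<in> {x - 1 - int k..x + 1 + int k}" by auto
    then show ?thesis
    proof cases
      case 1
      then obtain y where y: "d dvd y" "v = cyc y"
        using can_forceD(4)[OF force] by (auto simp: arc_zero_iff)
      show ?thesis
      proof (rule ccontr)
        assume v: "v \<notin> ?U (Suc k)"
        \<comment> \<open>The interval is symmetric about \<open>x\<close>, so a mirror image inside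
          it would put the hub \<open>v\<close> inside as well.\<close>
        have "cyc (2 * x - y) \<notin> ?U k"
        proof
          assume "cyc (2 * x - y) \<in> ?U k"
          then obtain z where z: "cyc (2 * x - y) = cyc z" "z \<in> {x - 1 - int k..x + 1 + int k}"
            by auto
          have "N dvd y - (2 * x - z)"
            using z(1) dvd_minus_iff[of N "2 * x - y - z"] by (simp add: cyc_eq_iff algebra_simps)
          then have "v = cyc (2 * x - z)" by (simp add: y(2) cyc_eq_iff)
          then have "v \<in> ?U k" using z(2) by auto
          then show False using v mono by blast
        qed
        then have "cyc (2 * x - y) \<notin> ?S" using Suc by blast
        moreover have "d dvd 2 * x - y" using x y(1) by auto
        ultimately have "cyc (2 * x - y) = cyc y"
          using white_hub[of ?S v "2 * x - y"] force 1 y(2) by auto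
        then have "N dvd 2 * (x - y)" by (simp add: cyc_eq_iff algebra_simps)
        moreover obtain t where t: "x - y = d * t" using x y(1) dvd_diff by blast
        \<comment> \<open>The factor 2 cancels because \<open>m\<close> is odd, hence a hub equal to
          its mirror image is \<open>cyc x\<close>.\<close>
        ultimately have "int m dvd 2 * t"
          using d_ge by (simp add: N_eq mult.left_commute mult.commute[of "int m"])
        then have "int m dvd t"
          using m by (simp add: coprime_dvd_mult_right_iff)
        then have "N dvd x - y" by (simp add: t N_eq mult.commute[of "int m"])
        then have "v = cyc x" by (simp add: y(2) cyc_eq_iff dvd_diff_commute)
        then show False using v by auto
      qed
    next
      case 2
      then show ?thesis using can_force_rim[of ?S y v] force by auto
    qed
  qed
  then show ?case using Suc mono by auto
qed (use B in auto)

text \<open>At most two blue rim vertices initially, or four after one step, weakens the count to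
  \<open>2 * m \<le> 2 * k + 3\<close>, and parity gives the claim. Otherwise \<open>B\<close> is a
  hub with both rim neighbors, and symmetry applies.\<close>

lemma m_le_if_odd:
  assumes odd: "odd m" "r = 1" and B: "B \<subseteq> pverts G" "card B \<le> 3"
    and full: "blue_after G B k = pverts G"
  shows "int m - 1 \<le> int k"
proof -
  have d: "d = 2" unfolding d_def using odd(2) by simp
  have N: "N = 2 * int m" unfolding N_eq d by simp
  have fin: "finite B" using B(1) finite_pverts by (rule finite_subset)
  consider "card (rim B) \<le> 2" | "card (rim (blue_after G B 1)) \<le> 4"
    | "2 < card (rim B)" "4 < card (rim (blue_after G B 1))" by linarith
  then show ?thesis
  proof cases
    case 1
    then show ?thesis using N_le_rim[OF B le0 full] N by simp
  next
    case 2
    have "k \<noteq> 0"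
      using N_le[OF B full] N_ge by auto
    then show ?thesis using N_le_rim[OF B _ full, of 1] N 2 by simp
  next
    case 3
    have "rim B \<subseteq> B" by (simp add: rim_def)
    then have rimB: "rim B = B" using 3(1) B(2) fin by (intro card_seteq) auto
    have zero: "0 \<notin> B"
    proof
      assume "0 \<in> B"
      then have "0 \<in> rim B" using rimB by simp
      then show False by (auto simp: rim_def)
    qed
    let ?F = "{v. \<exists>u. can_force G B u v}"
    have "\<not> ?F \<inter> range cyc \<subseteq> {v}" for v
    proof
      assume "?F \<inter> range cyc \<subseteq> {v}"
      then have "rim (blue_after G B 1) \<subseteq> insert v B" by (auto simp: rim_def)
      then have "card (rim (blue_after G B 1)) \<le> card (insert v B)"
        using fin by (intro card_mono) auto
      then show False using 3(2) B(2) fin by (simp add: card_insert_if split: if_splits)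
    qed
    then obtain v1 v2 where v: "v1 \<in> ?F \<inter> range cyc" "v2 \<in> ?F \<inter> range cyc" "v1 \<noteq> v2"
      by blast
    \<comment> \<open>The center is white, so no hub forces a rim vertex. For \<open>d = 2\<close>
      hubs alternate with the other rim vertices, so the blue neighbor such a force needs is a
      hub.\<close>
    have forcer: "\<exists>a b. can_force G B (cyc a) v \<and> \<not> d dvd a \<and> cyc b \<in> B \<and> d dvd b
        \<and> (a = b + 1 \<or> a = b - 1)"
      if vF: "v \<in> ?F \<inter> range cyc" for v
    proof -
      obtain u where u: "can_force G B u v" using vF by blast
      then have "u \<in> rim B" using rimB can_forceD(1) by auto
      then obtain a where a: "u = cyc a" by (auto simp: rim_def)
      have force: "can_force G B (cyc a) v" using u a by simp
      have na: "\<not> d dvd a" using white_centre[OF force] zero vF by auto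
      have ne: "cyc (a + 1) \<noteq> cyc (a - 1)" using N_ge by (simp add: cyc_near)
      have "d dvd a + 1" "d dvd a - 1" using na by (auto simp: d)
      moreover have "cyc (a + 1) \<in> B \<or> cyc (a - 1) \<in> B"
        using ne white_rim[OF force, of "a + 1"] white_rim[OF force, of "a - 1"] by auto
      ultimately show ?thesis using force na
        by (metis add_diff_cancel_right' diff_add_cancel)
    qed
    obtain a1 b1 where 1: "can_force G B (cyc a1) v1" "\<not> d dvd a1" "cyc b1 \<in> B" "d dvd b1"
        "a1 = b1 + 1 \<or> a1 = b1 - 1" using forcer[OF v(1)] by blast
    obtain a2 b2 where 2: "can_force G B (cyc a2) v2" "\<not> d dvd a2" "cyc b2 \<in> B" "d dvd b2"
        "a2 = b2 + 1 \<or> a2 = b2 - 1" using forcer[OF v(2)] by blast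
    have a12: "cyc a1 \<noteq> cyc a2"
    proof
      assume "cyc a1 = cyc a2"
      then have "(cyc a1, v2) \<in> parcs G" using can_forceD(4)[OF 2(1)] by simp
      then have "v2 = v1"
        using can_force_unique[OF 1(1)] can_forceD(2,3)[OF 2(1)] by blast
      then show False using v(3) by simp
    qed
    have ab: "cyc a \<noteq> cyc b" if "\<not> d dvd a" "d dvd b" for a b
      using that dvd_cyc by blast
    have aB: "cyc a1 \<in> B" "cyc a2 \<in> B" using can_forceD(1)[OF 1(1)] can_forceD(1)[OF 2(1)] .
    \<comment> \<open>Two forcers and one blue hub exhaust the three vertices of \<open>B\<close>,
      so both forcers flank the same hub.\<close>
    have Beq: "{cyc a1, cyc a2, cyc b} = B" if "cyc b \<in> B" "d dvd b" for b
    proof (rule card_seteq[OF fin])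
      show "{cyc a1, cyc a2, cyc b} \<subseteq> B" using aB that(1) by simp
      have "card {cyc a1, cyc a2, cyc b} = 3"
        using a12 ab[OF 1(2) that(2)] ab[OF 2(2) that(2)] by simp
      then show "card B \<le> card {cyc a1, cyc a2, cyc b}" using B(2) by simp
    qed
    have "cyc b2 \<in> {cyc a1, cyc a2, cyc b1}" using Beq[OF 1(3,4)] 2(3) by simp
    then have b12: "cyc b2 = cyc b1" using ab[OF 1(2) 2(4)] ab[OF 2(2) 2(4)] by simp
    have near: "cyc (b1 - 1) \<in> cyc ` {b1 - 1..b1 + 1}" "cyc b1 \<in> cyc ` {b1 - 1..b1 + 1}"
      "cyc (b1 + 1) \<in> cyc ` {b1 - 1..b1 + 1}" by simp_all
    have "cyc a1 = cyc (b1 + 1) \<or> cyc a1 = cyc (b1 - 1)" using 1(5) by blast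
    moreover have "cyc a2 = cyc (b1 + 1) \<or> cyc a2 = cyc (b1 - 1)"
      using 2(5) cyc_shift[OF b12, of 1] cyc_shift[OF b12, of "-1"] by auto
    ultimately have "{cyc a1, cyc a2, cyc b1} \<subseteq> cyc ` {b1 - 1..b1 + 1}"
      using near by (elim disjE) simp_all
    then have sub: "B \<subseteq> cyc ` {b1 - 1..b1 + 1}" unfolding Beq[OF 1(3,4)] .
    show ?thesis
    proof (rule ccontr)
      assume "\<not> int m - 1 \<le> int k"
      then have km: "int k \<le> int m - 2" by simp
      \<comment> \<open>The vertex opposite the hub: at distance \<open>m\<close> both ways around a
        rim of length \<open>2 * m\<close>, it lies outside the interval.\<close>
      have "cyc (b1 + int m) \<in> blue_after G B k" unfolding full by simp
      then obtain y where y: "cyc (b1 + int m) = cyc y" "b1 - 1 - int k \<le> y" "y \<le> b1 + 1 + int k"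
        using blue_after_symmetric[OF odd(1) 1(4) sub, of k] by auto
      then show False using km cyc_near[of "b1 + int m" y] N by auto
    qed
  qed
qed

section \<open>Growing blue intervals from three vertices\<close>

lemma rim_step:
  assumes "cyc x \<in> blue_after G B k" "d dvd x \<Longrightarrow> 0 \<in> blue_after G B k"
  shows "cyc (x - 1) \<in> blue_after G B k \<Longrightarrow> cyc (x + 1) \<in> blue_after G B (Suc k)"
    and "cyc (x + 1) \<in> blue_after G B k \<Longrightarrow> cyc (x - 1) \<in> blue_after G B (Suc k)"
  using assms by (auto intro!: blue_after_SucI[of "cyc x"] simp: arc_iff simp del: blue_after.simps)

lemma centre_step:
  assumes "d dvd x" "cyc ` {x - 1..x + 1} \<subseteq> blue_after G B k"
  shows "0 \<in> blue_after G B (Suc k)"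
  using assms by (intro blue_after_SucI[of "cyc x"]) (auto simp: arc_iff)

lemma hub_step:
  assumes "0 \<in> blue_after G B k" "d dvd x"
    and "\<And>y. d dvd y \<Longrightarrow> cyc y \<noteq> cyc x \<Longrightarrow> cyc y \<in> blue_after G B k"
  shows "cyc x \<in> blue_after G B (Suc k)"
  using assms by (intro blue_after_SucI[of 0]) (auto simp: arc_zero_iff)

text \<open>With \<open>a < b\<close> each end has its inner neighbor blue, and with the center blue
  even an end that is a hub can force outward.\<close>

lemma blue_interval_Suc:
  assumes "insert 0 (cyc ` {a..b}) \<subseteq> blue_after G B k" "a < b"
  shows "insert 0 (cyc ` {a - 1..b + 1}) \<subseteq> blue_after G B (Suc k)"
proof -
  have S: "0 \<in> blue_after G B k" "\<And>x. a \<le> x \<Longrightarrow> x \<le> b \<Longrightarrow> cyc x \<in> blue_after G B k"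
    using assms(1) by auto
  have "cyc (b + 1) \<in> blue_after G B (Suc k)" "cyc (a - 1) \<in> blue_after G B (Suc k)"
    using S assms(2) by (auto intro!: rim_step simp del: blue_after.simps)
  moreover have "{a - 1..b + 1} = insert (a - 1) (insert (b + 1) {a..b})"
    using assms(2) by auto
  moreover have "blue_after G B k \<subseteq> blue_after G B (Suc k)" by auto
  ultimately show ?thesis using assms(1) by (simp del: blue_after.simps) blast
qed

lemma blue_interval_add:
  assumes "insert 0 (cyc ` {a..b}) \<subseteq> blue_after G B k" "a < b"
  shows "insert 0 (cyc ` {a - int j..b + int j}) \<subseteq> blue_after G B (k + j)"
proof (induction j)
  case (Suc j)
  then show ?case
    using blue_interval_Suc[OF Suc] assms(2) by (simp add: algebra_simps del: blue_after.simps)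
qed (use assms in simp)

lemma blue_interval_full:
  assumes "insert 0 (cyc ` {a..b}) \<subseteq> blue_after G B k" "N \<le> b - a + 1" "B \<subseteq> pverts G"
  shows "blue_after G B k = pverts G"
proof
  show "blue_after G B k \<subseteq> pverts G" by (rule blue_after_subset[OF assms(3)])
  have "cyc x \<in> cyc ` {a..b}" for x
  proof (rule image_eqI)
    \<comment> \<open>The representative of \<open>x\<close> among the \<open>N\<close> consecutive
      coordinates starting at \<open>a\<close>.\<close>
    show "cyc x = cyc (a + (x - a) mod N)"
      by (simp add: cyc_eq_iff mod_eq_dvd_iff[symmetric] algebra_simps mod_simps)
    show "a + (x - a) mod N \<in> {a..b}"
      using assms(2) mod_N[of "x - a"] by simp
  qed
  then show "pverts G \<subseteq> blue_after G B k"
    using assms(1) by (auto simp: pverts_eq)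
qed

text \<open>In the first step the hub \<open>cyc 0\<close> forces the center while its two rim
  neighbors, which are not hubs, force outward; from then on both ends advance every step.\<close>

lemma blue_around_hub:
  "insert 0 (cyc ` {-2 - int j..2 + int j}) \<subseteq> blue_after G {cyc (-1), cyc 0, cyc 1} (1 + j)"
proof (rule blue_interval_add)
  let ?B = "{cyc (-1), cyc 0, cyc 1}"
  have e: "{-2..2::int} = {-2, -1, 0, 1, 2}" by auto
  have n: "\<not> d dvd 1" "\<not> d dvd -1" using d_ge by auto
  have "cyc 2 \<in> blue_after G ?B (Suc 0)" "cyc (-2) \<in> blue_after G ?B (Suc 0)"
    using rim_step(1)[of 1 ?B 0] rim_step(2)[of "-1" ?B 0] n by (simp_all del: blue_after.simps(2))
  moreover have "0 \<in> blue_after G ?B (Suc 0)"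
  proof (rule centre_step)
    have "{0 - 1..0 + 1::int} = {-1, 0, 1}" by auto
    then show "cyc ` {0 - 1..0 + 1} \<subseteq> blue_after G ?B 0" by simp
  qed simp
  moreover have "?B \<subseteq> blue_after G ?B (Suc 0)" by auto
  ultimately show "insert 0 (cyc ` {-2..2}) \<subseteq> blue_after G ?B 1"
    unfolding One_nat_def e by (simp del: blue_after.simps(2))
qed simp

text \<open>After \<open>k\<close> steps the interval covers \<open>2 * k + 3\<close> coordinates;
  no force by the center is counted.\<close>

lemma forcing_around_hub:
  assumes "N \<le> 2 * int k + 3"
  shows "\<exists>B \<subseteq> pverts G. card B \<le> 3 \<and> blue_after G B k = pverts G"
proof (intro exI conjI)
  let ?B = "{cyc (-1), cyc 0, cyc 1}"
  show "?B \<subseteq> pverts G" by simp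
  show "card ?B \<le> 3" by (simp add: card_insert_if)
  have "1 \<le> k" using assms N_ge by linarith
  then obtain j where j: "k = 1 + j" using le_Suc_ex by blast
  show "blue_after G ?B k = pverts G"
    using blue_around_hub[of j] assms unfolding j
    by (intro blue_interval_full) auto
qed

text \<open>For even \<open>m\<close> the vertex opposite \<open>cyc 0\<close> is a hub. All other
  hubs are blue one step before the end, so the center forces it while the interval makes its last
  extension, which saves a step.\<close>

lemma forcing_even:
  assumes "even m"
  shows "\<exists>B \<subseteq> pverts G. card B \<le> 3 \<and> blue_after G B (nat (N div 2 - 2)) = pverts G"
proof (intro exI conjI)
  let ?B = "{cyc (-1), cyc 0, cyc 1}"
  show sub: "?B \<subseteq> pverts G" by simp
  show "card ?B \<le> 3" by (simp add: card_insert_if)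
  obtain m' where m': "int m = 2 * m'" using assms by (metis evenE even_of_nat)
  define M where "M = m' * d"
  have N: "N = 2 * M" by (simp add: N_eq m' M_def)
  have "m' \<ge> 2" using m' m_ge by linarith
  then have "M \<ge> 2 * d" unfolding M_def using d_ge by (intro mult_right_mono) auto
  then have M: "M \<ge> 4" using d_ge by linarith
  \<comment> \<open>After \<open>1 + j = M - 3\<close> steps the interval reaches
    \<open>M - 2\<close> on both sides, hence every hub but \<open>cyc M\<close>, as
    \<open>d \<ge> 2\<close>.\<close>
  define j where "j = nat (M - 4)"
  have j: "int j = M - 4" using M by (simp add: j_def)
  have blue: "insert 0 (cyc ` {2 - M..M - 2}) \<subseteq> blue_after G ?B (1 + j)"
    using blue_around_hub[of j] j by simp
  have "cyc M \<in> blue_after G ?B (Suc (1 + j))"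
  proof (rule hub_step)
    show "d dvd M" by (simp add: M_def)
    fix y assume y: "d dvd y" "cyc y \<noteq> cyc M"
    \<comment> \<open>The representative of \<open>y\<close> in the window of length
      \<open>N\<close> from \<open>- M\<close> to \<open>M - 1\<close>.\<close>
    define z where "z = (y + M) mod N - M"
    have zy: "cyc z = cyc y"
      by (simp add: z_def cyc_eq_iff mod_eq_dvd_iff[symmetric] mod_simps)
    have dz: "d dvd z" using dvd_cyc[OF zy] y(1) by simp
    have range: "- M \<le> z" "z < M"
      using N mod_N[of "y + M"] unfolding z_def by linarith+
    have "cyc (- M) = cyc M" by (simp add: cyc_eq_iff N)
    then have "z \<noteq> - M" using zy y(2) by auto
    moreover have "d dvd z + M" "d dvd M - z" using dz by (auto simp: M_def)
    ultimately have "d \<le> z + M" "d \<le> M - z"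
      using range by (auto intro: zdvd_imp_le)
    then have "z \<in> {2 - M..M - 2}" using d_ge by auto
    then show "cyc y \<in> blue_after G ?B (1 + j)" using blue zy by (metis image_subset_iff insert_subset)
  qed (use blue in simp)
  moreover have "insert 0 (cyc ` {2 - M - 1..M - 2 + 1}) \<subseteq> blue_after G ?B (Suc (1 + j))"
    using blue M by (intro blue_interval_Suc) auto
  moreover have "{1 - M..M} = insert M {2 - M - 1..M - 2 + 1}" using M by auto
  ultimately have "insert 0 (cyc ` {1 - M..M}) \<subseteq> blue_after G ?B (Suc (1 + j))"
    by (simp del: blue_after.simps)
  then have "blue_after G ?B (Suc (1 + j)) = pverts G"
    using N by (intro blue_interval_full sub) auto
  moreover have "Suc (1 + j) = nat (N div 2 - 2)" using N j by simp
  ultimately show "blue_after G ?B (nat (N div 2 - 2)) = pverts G" by metis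
qed

text \<open>
  Starting from \<open>-2\<close>, \<open>-1\<close>, \<open>1\<close>, the blue interval is centered at \<open>-1\<close>
  instead of a hub, so its left end reaches the hub \<open>- (m - 1) * q\<close>, where \<open>d = 2 * q\<close>,
  before its right end reaches the last white hub \<open>(m - 1) * q\<close>. The center then forces
  that hub one step early, which gains the missing step.
\<close>

lemma forcing_odd:
  assumes "odd m" "even d" "d \<noteq> 2"
  shows "\<exists>B \<subseteq> pverts G. card B \<le> 3 \<and> blue_after G B (nat (N div 2 - 2)) = pverts G"
proof (intro exI conjI)
  let ?B = "{cyc (-2), cyc (-1), cyc 1}"
  show sub: "?B \<subseteq> pverts G" by simp
  show "card ?B \<le> 3" by (simp add: card_insert_if)
  obtain q where q: "d = 2 * q" using assms(2) by blast
  have q_ge: "q \<ge> 2" using d_ge assms(3) q by linarith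
  obtain n where n: "int m = 2 * n + 1" using assms(1) by (metis oddE even_of_nat)
  have n_ge: "n \<ge> 1" using n m_ge by linarith
  define M where "M = n * d"
  have N: "N = 2 * M + d" by (simp add: N_eq n M_def algebra_simps)
  have "M \<ge> 1 * d" unfolding M_def using n_ge d_ge by (intro mult_right_mono) auto
  then have M: "M \<ge> 4" using q_ge q by linarith
  \<comment> \<open>Here \<open>d \<ge> 4\<close>, so these rim vertices can force before the center
    is blue.\<close>
  have nd: "\<not> d dvd 1" "\<not> d dvd -1" "\<not> d dvd -2" "\<not> d dvd -3"
    using q_ge q by (auto dest!: zdvd_imp_le)
  have "cyc (-3) \<in> blue_after G ?B (Suc 0)" "cyc 0 \<in> blue_after G ?B (Suc 0)"
    using rim_step(2)[of "-2" ?B 0] rim_step(1)[of "-1" ?B 0] nd by (simp_all del: blue_after.simps(2))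
  moreover have "?B \<subseteq> blue_after G ?B (Suc 0)" by auto
  ultimately have one: "{cyc (-3), cyc (-2), cyc (-1), cyc 0, cyc 1} \<subseteq> blue_after G ?B (Suc 0)"
    by (simp del: blue_after.simps(2))
  have "cyc (-4) \<in> blue_after G ?B (Suc (Suc 0))" "cyc 2 \<in> blue_after G ?B (Suc (Suc 0))"
    using rim_step(2)[of "-3" ?B "Suc 0"] rim_step(1)[of 1 ?B "Suc 0"] nd one
    by (simp_all del: blue_after.simps(2))
  moreover have "0 \<in> blue_after G ?B (Suc (Suc 0))"
  proof (rule centre_step)
    have "{0 - 1..0 + 1::int} = {-1, 0, 1}" by auto
    then show "cyc ` {0 - 1..0 + 1} \<subseteq> blue_after G ?B (Suc 0)" using one by (simp del: blue_after.simps(2))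
  qed simp
  moreover have "blue_after G ?B (Suc 0) \<subseteq> blue_after G ?B (Suc (Suc 0))" by (rule blue_after_mono) simp
  moreover have "{-4..2::int} = {-4, -3, -2, -1, 0, 1, 2}" by auto
  ultimately have two: "insert 0 (cyc ` {-4..2}) \<subseteq> blue_after G ?B 2"
    using one unfolding numeral_2_eq_2 by (simp del: blue_after.simps(2)) blast
  \<comment> \<open>After \<open>2 + j = M - 2\<close> steps the interval is
    \<open>{- M..M - 2}\<close> and holds the hubs \<open>- n * d\<close> to
    \<open>(n - 1) * d\<close>, all \<open>m = 2 * n + 1\<close> but \<open>cyc M\<close>.\<close>
  define j where "j = nat (M - 4)"
  have j: "int j = M - 4" using M by (simp add: j_def)
  have blue: "insert 0 (cyc ` {- M..M - 2}) \<subseteq> blue_after G ?B (2 + j)"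
    using blue_interval_add[OF two, of j] j by simp
  have "cyc M \<in> blue_after G ?B (Suc (2 + j))"
  proof (rule hub_step)
    show "d dvd M" by (simp add: M_def)
    fix y assume y: "d dvd y" "cyc y \<noteq> cyc M"
    define z where "z = (y + M) mod N - M"
    have zy: "cyc z = cyc y"
      by (simp add: z_def cyc_eq_iff mod_eq_dvd_iff[symmetric] mod_simps)
    have dz: "d dvd z" using dvd_cyc[OF zy] y(1) by simp
    have range: "- M \<le> z" "z < M + d"
      using N mod_N[of "y + M"] unfolding z_def by linarith+
    have "z \<noteq> M" using zy y(2) by auto
    moreover have "d dvd M - z" "d dvd z - M" using dz by (auto simp: M_def)
    ultimately have "d \<le> M - z"
      using range zdvd_imp_le[of d "M - z"] zdvd_imp_le[of d "z - M"] by linarith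
    then have "z \<in> {- M..M - 2}" using d_ge range by auto
    then show "cyc y \<in> blue_after G ?B (2 + j)" using blue zy by (metis image_subset_iff insert_subset)
  qed (use blue in simp)
  moreover have "insert 0 (cyc ` {- M - 1..M - 2 + 1}) \<subseteq> blue_after G ?B (Suc (2 + j))"
    using blue M by (intro blue_interval_Suc) auto
  moreover have "{- M - 1..M} = insert M {- M - 1..M - 2 + 1}" using M by auto
  ultimately have "insert 0 (cyc ` {- M - 1..M}) \<subseteq> blue_after G ?B (Suc (2 + j))"
    by (simp del: blue_after.simps)
  \<comment> \<open>The \<open>2 * M + 2\<close> coordinates now covered leave
    \<open>d - 2 = 2 * (q - 1)\<close> vertices, filled from both sides in \<open>q - 1\<close>
    steps.\<close>
  then have "insert 0 (cyc ` {- M - 1 - int (nat (q - 1))..M + int (nat (q - 1))})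
      \<subseteq> blue_after G ?B (Suc (2 + j) + nat (q - 1))"
    using M by (intro blue_interval_add) auto
  then have "blue_after G ?B (Suc (2 + j) + nat (q - 1)) = pverts G"
    using N q q_ge by (intro blue_interval_full sub) auto
  moreover have "Suc (2 + j) + nat (q - 1) = nat (N div 2 - 2)"
    using N q q_ge j M by (simp add: nat_eq_iff)
  ultimately show "blue_after G ?B (nat (N div 2 - 2)) = pverts G" by metis
qed

section \<open>Determination of the propagation time\<close>

text \<open>The given set and the lower bound of three show that the zero forcing number is 3, so
  bounds over all sets of at most three vertices suffice.\<close>

lemma propagation_timeI:
  assumes "\<exists>B \<subseteq> pverts G. card B \<le> 3 \<and> blue_after G B k = pverts G"
    and lower: "\<And>B l. B \<subseteq> pverts G \<Longrightarrow> card B \<le> 3 \<Longrightarrow> blue_after G B l = pverts G \<Longrightarrow> k \<le> l"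
  shows "propagation_time G = k"
proof (rule antisym)
  obtain B where B: "B \<subseteq> pverts G" "card B \<le> 3" "blue_after G B k = pverts G"
    using assms(1) by blast
  have zfs: "zero_forcing_set G B" using finite_pverts B by (intro zero_forcing_setI)
  obtain B' where B': "zero_forcing_set G B'" "card B' = zero_forcing_number G"
      "propagation_time_of G B' = propagation_time G"
    using propagation_time_attained by blast
  have le: "zero_forcing_number G \<le> card B" by (rule zero_forcing_number_le[OF zfs])
  then have "card B = zero_forcing_number G"
    using zero_forcing_card_ge[OF B'(1)] B'(2) B(2) by linarith
  then show "propagation_time G \<le> k" by (rule propagation_time_le[OF zfs _ B(3)])
  have "B' \<subseteq> pverts G" using B'(1) by (simp add: zero_forcing_set_def)
  then show "k \<le> propagation_time G"
    using le B'(2,3) B(2) propagation_time_of_attained[OF B'(1)] by (intro lower[of B']) auto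
qed

theorem propagation_time_odd:
  assumes "odd m" "r = 1"
  shows "propagation_time G = m - 1"
proof (rule propagation_timeI)
  have "N = 2 * int m" unfolding N_def using assms(2) by simp
  then show "\<exists>B \<subseteq> pverts G. card B \<le> 3 \<and> blue_after G B (m - 1) = pverts G"
    using m_ge by (intro forcing_around_hub) auto
next
  fix B l assume "B \<subseteq> pverts G" "card B \<le> 3" "blue_after G B l = pverts G"
  from m_le_if_odd[OF assms this] show "m - 1 \<le> l" by linarith
qed

theorem propagation_time_general:
  assumes "\<not> (odd m \<and> r = 1)"
  shows "propagation_time G = nat ((N + 1) div 2 - 2)"
proof (rule propagation_timeI)
  show "\<exists>B \<subseteq> pverts G. card B \<le> 3 \<and> blue_after G B (nat ((N + 1) div 2 - 2)) = pverts G"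
  proof (cases "even N")
    case True
    have "even m \<or> even d" using True by (simp add: N_eq)
    moreover have "d \<noteq> 2" if "odd m" unfolding d_def using assms that by simp
    ultimately have "\<exists>B \<subseteq> pverts G. card B \<le> 3 \<and> blue_after G B (nat (N div 2 - 2)) = pverts G"
      using forcing_even forcing_odd by blast
    moreover have "(N + 1) div 2 = N div 2" using True by simp
    ultimately show ?thesis by simp
  next
    case False
    \<comment> \<open>For odd \<open>N\<close> the number of steps is \<open>(N - 3) / 2\<close>, so
      \<open>2 * k + 3\<close> equals \<open>N\<close> exactly.\<close>
    then show ?thesis using N_ge by (intro forcing_around_hub) (auto elim!: oddE)
  qed
next
  fix B l assume "B \<subseteq> pverts G" "card B \<le> 3" "blue_after G B l = pverts G"
  from N_le[OF this] show "nat ((N + 1) div 2 - 2) \<le> l" by linarith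
qed

end

theorem theorem2p4:
  fixes m r :: nat
  assumes "m \<ge> 3" and "r \<ge> 1"
  shows "int (propagation_time (gear_graph m r)) =
           (if odd m \<and> r = 1 then int m - 1 else \<lceil>real (m * (r + 1)) / 2\<rceil> - 2)"
proof -
  interpret gear m r using assms by unfold_locales
  have "\<lceil>real (m * (r + 1)) / 2\<rceil> = (N + 1) div 2"
  proof -
    have "\<lceil>real_of_int N / real_of_int 2\<rceil> = - (- N div 2)"
      by (rule ceiling_divide_eq_div)
    also have "\<dots> = (N + 1) div 2" by linarith
    finally show ?thesis by (simp add: N_def)
  qed
  then show ?thesis
    using propagation_time_odd propagation_time_general assms(1) N_ge by auto
qed

end
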